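(* Let $R$ be a graph on $s$ vertices having exactly $\ell$ vertices of degree one, and such that no connected component of $R$ is isomorphic to $K_1$ or to $K_2$. Then \[ \phi(R)\le 2^{s}+(s-\ell-2)2^{s-\ell-1}. \]
   Context: Graphs are finite and simple. For a graph $R$ and nonempty $I\subseteq V(R)$, $\delta_I=\min\{d_R(x):x\in I\}$, and the fixed loss of $R$ is \[ \phi(R)=\sum_{\substack{I \text{ independent in } R\\ I\neq\emptyset}}\bigl(2^{\delta_I}-1\bigr). \] *)

theory Defs
  imports Complex_Main "Graph_Theory.Graph_Theory"
begin

text \<open>
  A finite simple graph is a \<^locale>\<open>graph\<close>: a finite symmetric digraph without loops or
  parallel arcs, so that each undirected edge is a pair of opposite arcs and the degree
  of a vertex is its \<^const>\<open>out_degree\<close>.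
\<close>

abbreviation degree :: "('a, 'b) pre_digraph \<Rightarrow> 'a \<Rightarrow> nat" where
  "degree R v \<equiv> out_degree R v"

text \<open>The constant \<^const>\<open>Digraph_Component.connected\<close> requires a nonempty vertex set.\<close>

definition connected_component :: "('a, 'b) pre_digraph \<Rightarrow> ('a, 'b) pre_digraph \<Rightarrow> bool" where
  "connected_component R C \<longleftrightarrow> pre_digraph.max_subgraph R Digraph_Component.connected C"

definition independent_in :: "('a, 'b) pre_digraph \<Rightarrow> 'a set \<Rightarrow> bool" where
  "independent_in R I \<longleftrightarrow> I \<subseteq> verts R \<and> (\<forall>u\<in>I. \<forall>v\<in>I. \<not> u \<rightarrow>\<^bsub>R\<^esub> v)"

definition min_degree_on :: "('a, 'b) pre_digraph \<Rightarrow> 'a set \<Rightarrow> nat" where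
  "min_degree_on R I = Min (degree R ` I)"

definition fixed_loss :: "('a, 'b) pre_digraph \<Rightarrow> real" where
  "fixed_loss R = (\<Sum>I | independent_in R I \<and> I \<noteq> {}. 2 ^ min_degree_on R I - 1)"

end

theory Submission
  imports Defs
begin

text \<open>
  Let \<open>L\<close> be the set of leaves and \<open>M\<close> its complement, with \<open>m = card M\<close>. The bound equals
  \<open>m 2\<^sup>m\<^sup>-\<^sup>1 + (2\<^sup>s - 2\<^sup>m)\<close>, the number of pairs \<open>v \<in> T \<subseteq> M\<close> plus the number of vertex sets
  meeting \<open>L\<close>. An independent set meeting \<open>L\<close> loses at most \<open>1\<close> and is counted by itself. The loss
  of a nonempty independent \<open>I \<subseteq> M\<close> is the number of nonempty \<open>S \<subseteq> N(x)\<close>, where \<open>x \<in> I\<close> has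
  minimum degree; count \<open>(I, S)\<close> by \<open>(x, T)\<close> with \<open>T = I \<union> S\<close>, which determines \<open>S = T \<inter> N(x)\<close>
  and \<open>I = T - N(x)\<close>. If \<open>T\<close> meets \<open>L\<close>, then \<open>T\<close> alone determines \<open>x\<close>, the only neighbour of a
  leaf in \<open>T\<close>, and \<open>T\<close> is not independent.
\<close>

definition neighbours :: "('a, 'b) pre_digraph \<Rightarrow> 'a \<Rightarrow> 'a set" where
  "neighbours G v = {w. v \<rightarrow>\<^bsub>G\<^esub> w}"

lemma (in graph) neighbours_subset_verts: "neighbours G v \<subseteq> verts G"
  unfolding neighbours_def using adj_in_verts by blast

lemma (in graph) finite_neighbours: "finite (neighbours G v)"
  using finite_subset[OF neighbours_subset_verts finite_verts] .

lemma (in graph) neighbours_sym: "w \<in> neighbours G v \<longleftrightarrow> v \<in> neighbours G w"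
  unfolding neighbours_def using arcs_ends_symmetric[OF sym_arcs] by blast

text \<open>Without parallel arcs, an arc leaving \<open>v\<close> is determined by its
  head.\<close>

lemma (in graph) card_neighbours: "card (neighbours G v) = degree G v"
proof -
  have "inj_on (head G) (out_arcs G v)"
    using no_multi_arcs by (auto simp: inj_on_def arc_to_ends_def)
  moreover have "head G ` out_arcs G v = neighbours G v"
    by (auto simp: neighbours_def arcs_ends_def arc_to_ends_def)
  ultimately show ?thesis
    unfolding out_degree_def using card_image by metis
qed

lemma card_member_subsets:
  assumes "finite M" "v \<in> M"
  shows "card {T. v \<in> T \<and> T \<subseteq> M} = 2 ^ (card M - 1)"
proof -
  have "{T. v \<in> T \<and> T \<subseteq> M} = insert v ` Pow (M - {v})"
  proof (intro equalityI subsetI)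
    fix T assume "T \<in> {T. v \<in> T \<and> T \<subseteq> M}"
    then have "T = insert v (T - {v})" "T - {v} \<in> Pow (M - {v})" by auto
    then show "T \<in> insert v ` Pow (M - {v})" by blast
  qed (use assms in auto)
  moreover have "inj_on (insert v) (Pow (M - {v}))"
    by (auto simp: inj_on_def)
  ultimately show ?thesis
    using assms by (simp add: card_image card_Pow)
qed

lemma (in graph) min_degree_on_attained:
  assumes "I \<subseteq> verts G" "I \<noteq> {}"
  obtains x where "x \<in> I" "min_degree_on G I = degree G x"
proof -
  have "finite I" using assms(1) finite_verts finite_subset by blast
  then have "Min (degree G ` I) \<in> degree G ` I" using assms(2) by (intro Min_in) auto
  then show ?thesis using that unfolding min_degree_on_def by blast
qed

lemma (in graph) min_degree_on_le:
  assumes "I \<subseteq> verts G" "x \<in> I"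
  shows "min_degree_on G I \<le> degree G x"
  unfolding min_degree_on_def using assms finite_subset[OF assms(1) finite_verts] by auto

text \<open>Truncated subtraction does no harm here: \<open>M\<close> is a subset of
  \<open>verts G\<close>, and for \<open>card M = 0\<close> the factor before the power
  vanishes.\<close>

theorem (in graph) fixed_loss_le:
  fixes L M
  defines "L \<equiv> {v \<in> verts G. degree G v = 1}"
  defines "M \<equiv> verts G - L"
  shows "fixed_loss G \<le> card M * 2 ^ (card M - 1) + (2 ^ card (verts G) - 2 ^ card M :: nat)"
proof -
  let ?N = "neighbours G"
  define A where "A = {I. independent_in G I \<and> I \<inter> L \<noteq> {}}"
  define B where "B = {I. independent_in G I \<and> I \<noteq> {} \<and> I \<inter> L = {}}"
  have indepD: "I \<subseteq> verts G" "\<And>x. x \<in> I \<Longrightarrow> I \<inter> ?N x = {}" if "independent_in G I" for I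
    using that by (auto simp: independent_in_def neighbours_def)
  have "A \<subseteq> Pow (verts G)" "B \<subseteq> Pow (verts G)"
    using indepD(1) by (auto simp: A_def B_def)
  then have fin: "finite A" "finite B" "finite M"
    using finite_verts by (simp_all add: M_def finite_subset[of _ "Pow (verts G)"])
  have MV: "M \<subseteq> verts G" by (simp add: M_def)

  \<comment> \<open>Ties for the minimum degree are broken once and for all, so that
    \<open>x\<close> is a function of \<open>I\<close>.\<close>
  have "\<forall>I. \<exists>x. I \<in> B \<longrightarrow> x \<in> I \<and> min_degree_on G I = degree G x"
    using min_degree_on_attained indepD(1) unfolding B_def
    by (metis (mono_tags, lifting) mem_Collect_eq)
  then obtain x where x: "\<And>I. I \<in> B \<Longrightarrow> x I \<in> I \<and> min_degree_on G I = degree G (x I)"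
    by metis
  \<comment> \<open>The fibre over \<open>I\<close> has as many elements as the loss of
    \<open>I\<close>; it is empty when \<open>x I\<close> is isolated.\<close>
  define P where "P = (SIGMA I:B. Pow (?N (x I)) - {{}})"
  define f where "f = (\<lambda>(I, S). (x I, I \<union> S))"
  have finP: "finite P"
    unfolding P_def using fin(2) finite_neighbours by (intro finite_SigmaI) auto
  have inj: "inj_on f P"
  proof (rule inj_onI)
    \<comment> \<open>Being independent and containing \<open>x I\<close>, the set \<open>I\<close>
      avoids the neighbourhood in which \<open>S\<close> lies.\<close>
    have decode: "I = snd (f (I, S)) - ?N (fst (f (I, S)))" "S = snd (f (I, S)) \<inter> ?N (fst (f (I, S)))"
      if "(I, S) \<in> P" for I S
      using that x[of I] indepD(2)[of I "x I"] by (auto simp: P_def B_def f_def)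
    fix p q assume "p \<in> P" "q \<in> P" "f p = f q"
    then show "p = q" using decode by (metis prod.collapse)
  qed
  have B_sum: "(\<Sum>I\<in>B. 2 ^ min_degree_on G I - 1 :: real) = card P"
  proof -
    have "real (card (Pow (?N (x I)) - {{}})) = 2 ^ min_degree_on G I - 1" if "I \<in> B" for I
      using x[OF that] finite_neighbours
      by (simp add: card_Diff_singleton card_Pow card_neighbours of_nat_diff)
    moreover have "card P = (\<Sum>I\<in>B. card (Pow (?N (x I)) - {{}}))"
      unfolding P_def using fin(2) finite_neighbours by (intro card_SigmaI) auto
    ultimately show ?thesis by simp
  qed

  define Q\<^sub>M where "Q\<^sub>M = {p \<in> f ` P. snd p \<subseteq> M}"
  define Q\<^sub>L where "Q\<^sub>L = {p \<in> f ` P. \<not> snd p \<subseteq> M}"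
  \<comment> \<open>As \<open>v \<in> T\<close>, the fourth conjunct shows that \<open>T\<close> is
    not independent. The last one, where \<open>T - ?N v\<close> is \<open>I\<close>, makes every
    leaf in \<open>T\<close> a neighbour of \<open>v\<close>.\<close>
  have fP: "v \<in> T \<and> v \<in> M \<and> T \<subseteq> verts G \<and> T \<inter> ?N v \<noteq> {} \<and> T - ?N v \<subseteq> M"
    if "(v, T) \<in> f ` P" for v T
  proof -
    from that obtain I S where IS: "(I, S) \<in> P" "v = x I" "T = I \<union> S" by (auto simp: f_def)
    then have I: "I \<in> B" "S \<subseteq> ?N v" "S \<noteq> {}" by (auto simp: P_def)
    then have "I \<subseteq> M" "v \<in> I" using indepD(1)[of I] x[of I] IS by (auto simp: B_def M_def)
    then show ?thesis using I IS MV neighbours_subset_verts[of v] by auto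
  qed
  have "card (f ` P) = card Q\<^sub>M + card Q\<^sub>L"
  proof -
    have "f ` P = Q\<^sub>M \<union> Q\<^sub>L" "Q\<^sub>M \<inter> Q\<^sub>L = {}" by (auto simp: Q\<^sub>M_def Q\<^sub>L_def)
    then show ?thesis using finP by (metis card_Un_disjoint finite_Un finite_imageI)
  qed
  then have P_card: "card P = card Q\<^sub>M + card Q\<^sub>L" using card_image[OF inj] by simp

  have QM_card: "card Q\<^sub>M \<le> card M * 2 ^ (card M - 1)"
  proof -
    \<comment> \<open>Inside \<open>M\<close> the set \<open>T\<close> need not determine
      \<open>v\<close> (take an edge of a triangle), so pairs are counted rather than sets.\<close>
    let ?S = "SIGMA v:M. {T. v \<in> T \<and> T \<subseteq> M}"
    have finT: "finite {T. v \<in> T \<and> T \<subseteq> M}" for v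
      using fin(3) by (auto intro: finite_subset[where B = "Pow M"])
    have "Q\<^sub>M \<subseteq> ?S"
    proof
      fix p assume "p \<in> Q\<^sub>M"
      then show "p \<in> ?S" using fP[of "fst p" "snd p"] by (cases p) (simp add: Q\<^sub>M_def)
    qed
    then have "card Q\<^sub>M \<le> card ?S" using fin(3) finT by (intro card_mono finite_SigmaI)
    also have "\<dots> = (\<Sum>v\<in>M. card {T. v \<in> T \<and> T \<subseteq> M})"
      using fin(3) finT by (intro card_SigmaI) auto
    also have "\<dots> = card M * 2 ^ (card M - 1)"
      using card_member_subsets[OF fin(3)] by simp
    finally show ?thesis .
  qed

  \<comment> \<open>The sets in \<open>A\<close> and the second components of
    \<open>Q\<^sub>L\<close> are disjoint families of vertex sets meeting \<open>L\<close>, so one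
    count of such sets pays for both.\<close>
  have QL_card: "card A + card Q\<^sub>L \<le> 2 ^ card (verts G) - 2 ^ card M"
  proof -
    have "inj_on snd Q\<^sub>L"
    proof (rule inj_onI)
      fix p q assume pq: "p \<in> Q\<^sub>L" "q \<in> Q\<^sub>L" "snd p = snd q"
      obtain v w T where vw: "p = (v, T)" "q = (w, T)" using pq(3) by (cases p, cases q) auto
      have v: "(v, T) \<in> f ` P" and w: "(w, T) \<in> f ` P" and "\<not> T \<subseteq> M"
        using pq vw by (auto simp: Q\<^sub>L_def)
      then obtain u where u: "u \<in> T" "u \<notin> M" by blast
      then have "u \<in> ?N v" "u \<in> ?N w" "u \<in> L"
        using fP[OF v] fP[OF w] by (auto simp: M_def)
      then have "{v, w} \<subseteq> ?N u" "card (?N u) = 1"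
        using neighbours_sym by (auto simp: L_def card_neighbours)
      then have "v = w" by (auto simp: card_1_singleton_iff)
      then show "p = q" using vw by simp
    qed
    then have "card (snd ` Q\<^sub>L) = card Q\<^sub>L" by (rule card_image)
    moreover have "A \<inter> snd ` Q\<^sub>L = {}"
    proof -
      have False if "independent_in G T" "(v, T) \<in> Q\<^sub>L" for v T
        using indepD(2)[OF that(1), of v] fP[of v T] that(2) by (auto simp: Q\<^sub>L_def)
      then show ?thesis by (auto simp: A_def)
    qed
    moreover have "finite Q\<^sub>L" using finP by (simp add: Q\<^sub>L_def)
    ultimately have "card A + card Q\<^sub>L = card (A \<union> snd ` Q\<^sub>L)"
      using fin(1) by (simp add: card_Un_disjoint)
    also have "\<dots> \<le> card (Pow (verts G) - Pow M)"
    proof (rule card_mono)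
      show "A \<union> snd ` Q\<^sub>L \<subseteq> Pow (verts G) - Pow M"
        using fP indepD(1) by (fastforce simp: A_def Q\<^sub>L_def M_def)
    qed simp
    also have "\<dots> = 2 ^ card (verts G) - 2 ^ card M"
      using MV fin(3) by (simp add: card_Diff_subset card_Pow Pow_mono)
    finally show ?thesis .
  qed

  have "fixed_loss G = (\<Sum>I\<in>A \<union> B. 2 ^ min_degree_on G I - 1)"
    unfolding fixed_loss_def by (rule sum.cong) (auto simp: A_def B_def)
  also have "\<dots> = (\<Sum>I\<in>A. 2 ^ min_degree_on G I - 1) + (\<Sum>I\<in>B. 2 ^ min_degree_on G I - 1)"
    using fin by (intro sum.union_disjoint) (auto simp: A_def B_def)
  \<comment> \<open>Only an inequality: besides a leaf, \<open>I\<close> may contain an isolated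
    vertex, and then its loss is 0.\<close>
  also have "(\<Sum>I\<in>A. 2 ^ min_degree_on G I - 1 :: real) \<le> (\<Sum>I\<in>A. 1)"
  proof (rule sum_mono)
    fix I assume "I \<in> A"
    then obtain u where "u \<in> I" "degree G u = 1" "I \<subseteq> verts G"
      using indepD(1) by (auto simp: A_def L_def)
    then have "min_degree_on G I \<le> 1" using min_degree_on_le by metis
    then have "(2::real) ^ min_degree_on G I \<le> 2 ^ 1" by (intro power_increasing) auto
    then show "2 ^ min_degree_on G I - 1 \<le> (1::real)" by simp
  qed
  also have "(\<Sum>I\<in>A. 1) + (\<Sum>I\<in>B. 2 ^ min_degree_on G I - 1) = real (card A + card P)"
    using B_sum by simp
  also have "\<dots> \<le> real (card M * 2 ^ (card M - 1) + (2 ^ card (verts G) - 2 ^ card M))"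
    using P_card QM_card QL_card by (intro of_nat_mono) linarith
  finally show ?thesis by simp
qed

theorem theorem4p8:
  fixes R :: "('a, 'b) pre_digraph" and s l :: nat
  assumes "graph R"
    and "card (verts R) = s"
    and "card {v \<in> verts R. degree R v = 1} = l"
    and "\<And>C. connected_component R C \<Longrightarrow> \<not> K\<^bsub>1\<^esub> C \<and> \<not> K\<^bsub>2\<^esub> C"
  shows "fixed_loss R \<le> 2 ^ s + (real s - real l - 2) * 2 powi (int s - int l - 1)"
proof -
  interpret graph R by fact
  let ?L = "{v \<in> verts R. degree R v = 1}"
  define m where "m = card (verts R - ?L)"
  have sl: "s = l + m"
    using card_Diff_subset[of ?L "verts R"] card_mono[of "verts R" ?L] assms(2,3) finite_verts
    by (simp add: m_def)
  have "fixed_loss R \<le> m * 2 ^ (m - 1) + (2 ^ s - 2 ^ m :: nat)"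
    using fixed_loss_le assms(2) by (simp add: m_def)
  also have "\<dots> = real m * 2 ^ (m - 1) + (2 ^ s - 2 ^ m)"
  proof -
    \<comment> \<open>By \<open>sl\<close>, m \<le> s, so the cast commutes with the
      subtraction.\<close>
    have "real (2 ^ s - 2 ^ m) = 2 ^ s - 2 ^ m"
      using of_nat_diff[of "2 ^ m" "2 ^ s", where ?'a = real] by (simp add: sl)
    then show ?thesis by (simp only: of_nat_add of_nat_mult of_nat_power of_nat_numeral)
  qed
  \<comment> \<open>For m = 0 the natural exponent truncates to 0 while the integer one is -1; both
    sides are then \<open>2 ^ s - 1\<close>. Otherwise \<open>2 ^ m\<close> is twice
    \<open>2 ^ (m - 1)\<close>.\<close>
  also have "\<dots> = 2 ^ s + (real m - 2) * 2 powi (int m - 1)"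
    by (cases m) (simp_all add: algebra_simps power_int_minus)
  finally show ?thesis by (simp add: sl)
qed

end
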